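(* Let $X_1,\dots,X_m$ be finite non-empty sets, $X=X_1\times\dots\times X_m$, and let $\epsilon>0$. Then \[ \frac{|\{g\in\mathcal{A}(X): g\text{ is }\epsilon\text{-bad}\}|}{|\mathcal{A}(X)|}\le 2^{1+|X|-\prod_{i=1}^m(|X_i|-1)}\cdot\exp(-2\epsilon^2|X|). \]
   Context: Let $V=\{F:X\to\mathbb{F}_2\}$ and $W=\{g:X\times X\to\mathbb{F}_2\}$. For $x_1,x_2\in X$ and $\mathbf v=(v_1,\dots,v_m)\in\{1,2\}^m$, let $\mathbf v(x_1,x_2)\in X$ be the element whose $j$-th coordinate equals the $j$-th coordinate of $x_{v_j}$. Define the linear map $d:V\to W$ by $dF(x_1,x_2)=\sum_{\mathbf v\in\{1,2\}^m}F(\mathbf v(x_1,x_2))$, and $\mathcal{A}(X)=\mathrm{im}(d)$. A function $F\in V$ is $\epsilon$-bad if $\big||F^{-1}(0)|-|X|/2\big|\ge\epsilon|X|$, and $g\in\mathcal{A}(X)$ is $\epsilon$-bad if $g=dF$ for some $\epsilon$-bad $F$. *)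

theory Defs
  imports Complex_Main "HOL-Library.FuncSet" "HOL-Library.Z2"
begin

(* The field F_2 is the type bit. The sets X_1, ..., X_m are given as a family S on {1..m};
   functions with a restricted domain are the extensional functions of FuncSet, so that
   equality and cardinality of sets of such functions have their usual meaning. *)

definition prod_set :: "nat \<Rightarrow> (nat \<Rightarrow> 'a set) \<Rightarrow> (nat \<Rightarrow> 'a) set" where
  "prod_set m S = (\<Pi>\<^sub>E i\<in>{1..m}. S i)"

definition V_space :: "nat \<Rightarrow> (nat \<Rightarrow> 'a set) \<Rightarrow> ((nat \<Rightarrow> 'a) \<Rightarrow> bit) set" where
  "V_space m S = (prod_set m S \<rightarrow>\<^sub>E (UNIV :: bit set))"

definition W_space ::
  "nat \<Rightarrow> (nat \<Rightarrow> 'a set) \<Rightarrow> ((nat \<Rightarrow> 'a) \<times> (nat \<Rightarrow> 'a) \<Rightarrow> bit) set" where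
  "W_space m S = (prod_set m S \<times> prod_set m S \<rightarrow>\<^sub>E (UNIV :: bit set))"

(* The point written v(x1,x2) for v in {1,2}^m. *)
definition mix ::
  "nat \<Rightarrow> (nat \<Rightarrow> nat) \<Rightarrow> (nat \<Rightarrow> 'a) \<Rightarrow> (nat \<Rightarrow> 'a) \<Rightarrow> (nat \<Rightarrow> 'a)" where
  "mix m v x1 x2 = (\<lambda>j\<in>{1..m}. if v j = 1 then x1 j else x2 j)"

definition d_map ::
  "nat \<Rightarrow> (nat \<Rightarrow> 'a set) \<Rightarrow> ((nat \<Rightarrow> 'a) \<Rightarrow> bit) \<Rightarrow> ((nat \<Rightarrow> 'a) \<times> (nat \<Rightarrow> 'a) \<Rightarrow> bit)" where
  "d_map m S F =
     (\<lambda>(x1, x2) \<in> prod_set m S \<times> prod_set m S. \<Sum>v \<in> {1..m} \<rightarrow>\<^sub>E {1, 2}. F (mix m v x1 x2))"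

definition A_space ::
  "nat \<Rightarrow> (nat \<Rightarrow> 'a set) \<Rightarrow> ((nat \<Rightarrow> 'a) \<times> (nat \<Rightarrow> 'a) \<Rightarrow> bit) set" where
  "A_space m S = d_map m S ` V_space m S"

definition bad_V ::
  "nat \<Rightarrow> (nat \<Rightarrow> 'a set) \<Rightarrow> real \<Rightarrow> ((nat \<Rightarrow> 'a) \<Rightarrow> bit) \<Rightarrow> bool" where
  "bad_V m S \<epsilon> F \<longleftrightarrow>
     \<bar>real (card {x \<in> prod_set m S. F x = 0}) - real (card (prod_set m S)) / 2\<bar>
       \<ge> \<epsilon> * real (card (prod_set m S))"

definition bad_A ::
  "nat \<Rightarrow> (nat \<Rightarrow> 'a set) \<Rightarrow> real \<Rightarrow> ((nat \<Rightarrow> 'a) \<times> (nat \<Rightarrow> 'a) \<Rightarrow> bit) \<Rightarrow> bool" where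
  "bad_A m S \<epsilon> g \<longleftrightarrow> (\<exists>F \<in> V_space m S. bad_V m S \<epsilon> F \<and> g = d_map m S F)"

lemma mix_in_prod_set:
  assumes "x1 \<in> prod_set m S" "x2 \<in> prod_set m S"
  shows "mix m v x1 x2 \<in> prod_set m S"
  using assms by (auto simp: prod_set_def mix_def PiE_iff)

lemma d_map_in_W_space: "d_map m S F \<in> W_space m S"
  unfolding W_space_def d_map_def by simp

lemma d_map_add:
  "d_map m S (\<lambda>x\<in>prod_set m S. F x + G x) =
     (\<lambda>p \<in> prod_set m S \<times> prod_set m S. d_map m S F p + d_map m S G p)"
proof -
  have "(\<Sum>v \<in> I. (\<lambda>x\<in>prod_set m S. F x + G x) (mix m v x1 x2))
      = (\<Sum>v \<in> I. F (mix m v x1 x2)) + (\<Sum>v \<in> I. G (mix m v x1 x2))"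
    if "x1 \<in> prod_set m S" "x2 \<in> prod_set m S" for x1 x2 and I :: "(nat \<Rightarrow> nat) set"
    using that by (simp only: restrict_apply' mix_in_prod_set sum.distrib)
  then show ?thesis
    unfolding d_map_def by (intro restrict_ext) (clarsimp simp del: add_bit_eq_xor)
qed

end

theory Submission
  imports Defs "HOL-Probability.Hoeffding"
begin

text \<open>
  At most $2^{|X|+1}\exp(-2\epsilon^2|X|)$ functions are bad, by Hoeffding's inequality, and $d$
  maps them onto the bad elements of $\mathcal{A}(X)$. Conversely, fix a base point $a \in X$. If
  $F$ is supported on the points $x$ that differ from $a$ in every coordinate, then the only nonzero
  term of $dF(x,a)$ at such an $x$ is $F(x)$. Hence $d$ is injective on these functions, and
  $|\mathcal{A}(X)| \ge 2^{\prod_i(|X_i|-1)}$.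
\<close>

text \<open>The successes among independent fair coins indexed by \<open>A\<close> form a uniformly
  random subset of \<open>A\<close>. This lets a count of subsets by size be read off the binomial
  distribution.\<close>

lemma binomial_pmf_half_conv_Pow:
  assumes "finite A"
  shows "binomial_pmf (card A) (1/2) = map_pmf card (pmf_of_set (Pow A))"
proof -
  have "binomial_pmf (card A) (1/2) =
      map_pmf (\<lambda>f. card {x \<in> A. f x}) (Pi_pmf A False (\<lambda>_. bernoulli_pmf (1/2)))"
    by (rule binomial_pmf_altdef') (use assms in auto)
  also have "\<dots> = map_pmf card (map_pmf (\<lambda>f. {x \<in> A. f x})
      (Pi_pmf A False (\<lambda>_. bernoulli_pmf (1/2))))"
    by (simp add: map_pmf_comp)
  finally show ?thesis
    using pmf_of_set_Pow_conv_bernoulli[OF assms, of False] by simp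
qed

text \<open>Hoeffding's inequality for the size of a uniformly random subset. The leading 2 accounts
  for the two tails, and \<open>2 ^ card A\<close> turns the probability into a count.\<close>

lemma card_unbalanced_subsets_le:
  fixes \<epsilon> :: real
  assumes "finite A" "A \<noteq> {}" "\<epsilon> \<ge> 0"
  shows "real (card {B \<in> Pow A. \<bar>real (card B) - real (card A) / 2\<bar> \<ge> \<epsilon> * real (card A)})
    \<le> 2 * 2 ^ card A * exp (- 2 * \<epsilon>\<^sup>2 * real (card A))"
proof -
  define n where "n = card A"
  have n: "n > 0" using assms by (simp add: n_def card_gt_0_iff)
  interpret binomial_distribution n "1/2" by unfold_locales auto
  \<comment> \<open>The Hoeffding bound \<open>prob_abs_ge'\<close> concerns the relative frequency
    \<open>k / n\<close>, whereas badness is stated for absolute counts.\<close>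
  have scale: "\<bar>real k / real n - 1/2\<bar> \<ge> \<epsilon> \<longleftrightarrow> \<bar>real k - real n / 2\<bar> \<ge> \<epsilon> * real n" for k
  proof -
    have "real k / real n - 1/2 = (real k - real n / 2) / real n"
      using n by (simp add: field_simps)
    then show ?thesis
      using n by (simp add: abs_divide pos_le_divide_eq)
  qed
  have "real (card {B \<in> Pow A. \<bar>real (card B) - real n / 2\<bar> \<ge> \<epsilon> * real n}) / 2 ^ n
      = measure_pmf.prob (pmf_of_set (Pow A)) {B. \<bar>real (card B) / real n - 1/2\<bar> \<ge> \<epsilon>}"
    using assms by (subst measure_pmf_of_set)
      (auto simp: card_Pow n_def scale[unfolded n_def] Int_def)
  also have "\<dots> = measure_pmf.prob (binomial_pmf n (1/2)) {k. \<bar>real k / real n - 1/2\<bar> \<ge> \<epsilon>}"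
    using assms(1) by (simp add: n_def binomial_pmf_half_conv_Pow vimage_def)
  also have "\<dots> \<le> 2 * exp (- 2 * real n * \<epsilon>\<^sup>2)"
    using prob_abs_ge'[OF n assms(3)] by simp
  finally show ?thesis
    by (simp add: n_def field_simps)
qed

lemma bit_eq_iff_zero_iff: "(a :: bit) = b \<longleftrightarrow> (a = 0 \<longleftrightarrow> b = 0)"
  by (cases a; cases b) auto

lemma UNIV_bit: "(UNIV :: bit set) = {0, 1}"
  by (auto intro: bit.exhaust)

lemma finite_V_space: "finite (prod_set m S) \<Longrightarrow> finite (V_space m S)"
  unfolding V_space_def by (rule finite_PiE) (auto simp: UNIV_bit)

text \<open>A function into the two-element field is determined by its zero set, and it is bad
  exactly when that set is unbalanced.\<close>

lemma card_bad_V_le: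
  fixes \<epsilon> :: real
  assumes "finite (prod_set m S)" "prod_set m S \<noteq> {}" "\<epsilon> \<ge> 0"
  shows "real (card {F \<in> V_space m S. bad_V m S \<epsilon> F})
    \<le> 2 * 2 ^ card (prod_set m S) * exp (- 2 * \<epsilon>\<^sup>2 * real (card (prod_set m S)))"
proof -
  let ?X = "prod_set m S"
  let ?Z = "\<lambda>F. {x \<in> ?X. F x = (0 :: bit)}"
  have "inj_on ?Z (V_space m S)"
  proof (rule inj_onI)
    fix F G assume *: "F \<in> V_space m S" "G \<in> V_space m S" and Z: "?Z F = ?Z G"
    show "F = G"
      using * unfolding V_space_def
    proof (rule PiE_ext)
      fix x assume "x \<in> ?X"
      then show "F x = G x" using Z by (subst bit_eq_iff_zero_iff) blast
    qed
  qed
  then have "card {F \<in> V_space m S. bad_V m S \<epsilon> F}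
      \<le> card {B \<in> Pow ?X. \<bar>real (card B) - real (card ?X) / 2\<bar> \<ge> \<epsilon> * real (card ?X)}"
    by (intro card_inj_on_le[of ?Z])
      (auto simp: bad_V_def assms(1) intro: inj_on_subset)
  also note card_unbalanced_subsets_le[OF assms]
  finally show ?thesis by simp
qed

lemma finite_A_space: "finite (prod_set m S) \<Longrightarrow> finite (A_space m S)"
  by (simp add: A_space_def finite_V_space)

text \<open>The exponent counts the points that differ from \<open>a\<close> in every coordinate;
  functions on these are extended by zero to the whole product before \<open>d_map\<close> is
  applied.\<close>

lemma card_A_space_ge:
  assumes fin: "finite (prod_set m S)" and a: "a \<in> prod_set m S"
  shows "2 ^ card (prod_set m (\<lambda>i. S i - {a i})) \<le> card (A_space m S)"
proof -
  let ?X = "prod_set m S" and ?Y = "prod_set m (\<lambda>i. S i - {a i})"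
  let ?E = "\<lambda>f. \<lambda>x\<in>?X. if x \<in> ?Y then f x else (0 :: bit)"
  have YX: "?Y \<subseteq> ?X" unfolding prod_set_def by (intro PiE_mono) auto
  have finY: "finite ?Y" using YX fin by (rule finite_subset)
  have d: "d_map m S (?E f) (x, a) = f x" if x: "x \<in> ?Y" for f x
  proof -
    let ?I = "{1..m} \<rightarrow>\<^sub>E {1, 2 :: nat}"
    let ?one = "\<lambda>j\<in>{1..m}. 1 :: nat"
    have xX: "x \<in> ?X" using x YX by auto
    have "mix m ?one x a = x"
      using x by (auto simp: mix_def prod_set_def PiE_iff extensional_def fun_eq_iff)
    \<comment> \<open>Any other choice vector copies some coordinate from \<open>a\<close>, which
      moves the point out of \<open>?Y\<close>, where \<open>?E f\<close> vanishes.\<close>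
    moreover have "mix m v x a \<notin> ?Y" if v: "v \<in> ?I" "v \<noteq> ?one" for v
    proof -
      obtain j where "j \<in> {1..m}" "v j \<noteq> 1"
        \<comment> \<open>Both \<open>v\<close> and \<open>?one\<close> are extensional, so they
          must differ at an index inside \<open>{1..m}\<close>.\<close>
        using v by (auto simp: PiE_iff extensional_def fun_eq_iff split: if_splits)
      then have "mix m v x a j = a j" by (simp add: mix_def)
      with \<open>j \<in> {1..m}\<close> show ?thesis unfolding prod_set_def PiE_iff by blast
    qed
    ultimately have "?E f (mix m v x a) = (if v = ?one then f x else 0)" if "v \<in> ?I" for v
      using that x mix_in_prod_set[OF xX a] by simp
    then have "d_map m S (?E f) (x, a) = (\<Sum>v\<in>?I. if v = ?one then f x else 0)"
      using xX a unfolding d_map_def by simp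
    also have "\<dots> = f x"
      by (subst sum.delta) (auto intro: finite_PiE)
    finally show ?thesis .
  qed
  have "card (?Y \<rightarrow>\<^sub>E (UNIV :: bit set)) \<le> card (A_space m S)"
  proof (rule card_inj_on_le)
    show "inj_on (\<lambda>f. d_map m S (?E f)) (?Y \<rightarrow>\<^sub>E UNIV)"
    proof (rule inj_onI)
      fix f g assume *: "f \<in> ?Y \<rightarrow>\<^sub>E UNIV" "g \<in> ?Y \<rightarrow>\<^sub>E UNIV"
        and eq: "d_map m S (?E f) = d_map m S (?E g)"
      show "f = g"
        using *
      proof (rule PiE_ext)
        fix x assume "x \<in> ?Y"
        then show "f x = g x"
          \<comment> \<open>Evaluating the common image at \<open>(x, a)\<close> recovers both
            values at \<open>x\<close>.\<close>
          using d[of x f] d[of x g] fun_cong[OF eq, of "(x, a)"] by (simp only:)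
      qed
    qed
    show "(\<lambda>f. d_map m S (?E f)) ` (?Y \<rightarrow>\<^sub>E UNIV) \<subseteq> A_space m S"
      unfolding A_space_def V_space_def by (auto intro!: imageI)
  qed (rule finite_A_space[OF fin])
  moreover have "card (UNIV :: bit set) = 2"
    by (simp add: UNIV_bit)
  ultimately show ?thesis using finY by (simp add: card_PiE)
qed

theorem theorem3p3:
  fixes m :: nat and S :: "nat \<Rightarrow> 'a set" and \<epsilon> :: real
  assumes "\<And>i. i \<in> {1..m} \<Longrightarrow> finite (S i)"
    and "\<And>i. i \<in> {1..m} \<Longrightarrow> S i \<noteq> {}"
    and "\<epsilon> > 0"
  shows "real (card {g \<in> A_space m S. bad_A m S \<epsilon> g}) / real (card (A_space m S))
    \<le> 2 powr (1 + real (card (prod_set m S)) - (\<Prod>i = 1..m. (real (card (S i)) - 1)))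
        * exp (- 2 * \<epsilon>\<^sup>2 * real (card (prod_set m S)))"
proof -
  let ?X = "prod_set m S"
  have finX: "finite ?X" unfolding prod_set_def using assms(1) by (intro finite_PiE) auto
  obtain a where a: "a \<in> ?X"
    using assms(2) unfolding prod_set_def by (meson PiE_eq_empty_iff ex_in_conv)
  define k where "k = card (prod_set m (\<lambda>i. S i - {a i}))"
  have "real k = (\<Prod>i = 1..m. real (card (S i - {a i})))"
    unfolding k_def prod_set_def by (subst card_PiE) auto
  also have "\<dots> = (\<Prod>i = 1..m. real (card (S i)) - 1)"
  proof (rule prod.cong)
    fix i assume i: "i \<in> {1..m}"
    then have "a i \<in> S i" using a by (auto simp: prod_set_def)
    \<comment> \<open>Positivity ensures that the truncated subtraction on naturals agrees with the
      real one.\<close>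
    moreover have "card (S i) > 0" using i assms by (simp add: card_gt_0_iff)
    ultimately show "real (card (S i - {a i})) = real (card (S i)) - 1"
      by simp
  qed simp
  finally have k: "(\<Prod>i = 1..m. real (card (S i)) - 1) = real k" ..
  \<comment> \<open>One bad preimage suffices for badness, so passing to images cannot increase the
    count.\<close>
  have "{g \<in> A_space m S. bad_A m S \<epsilon> g} \<subseteq> d_map m S ` {F \<in> V_space m S. bad_V m S \<epsilon> F}"
    by (auto simp: bad_A_def)
  then have "card {g \<in> A_space m S. bad_A m S \<epsilon> g} \<le> card {F \<in> V_space m S. bad_V m S \<epsilon> F}"
    using finite_V_space[OF finX] by (intro surj_card_le) auto
  also have "real \<dots> \<le> 2 * 2 ^ card ?X * exp (- 2 * \<epsilon>\<^sup>2 * real (card ?X))"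
    by (rule card_bad_V_le) (use finX a assms(3) in auto)
  finally have num: "real (card {g \<in> A_space m S. bad_A m S \<epsilon> g})
    \<le> 2 * 2 ^ card ?X * exp (- 2 * \<epsilon>\<^sup>2 * real (card ?X))" by simp
  have "(2 ^ k :: real) \<le> real (card (A_space m S))"
    using card_A_space_ge[OF finX a] unfolding k_def by (metis of_nat_le_iff of_nat_numeral of_nat_power)
  with num have "real (card {g \<in> A_space m S. bad_A m S \<epsilon> g}) / real (card (A_space m S))
      \<le> 2 * 2 ^ card ?X * exp (- 2 * \<epsilon>\<^sup>2 * real (card ?X)) / 2 ^ k"
    by (intro frac_le) auto
  \<comment> \<open>The exponent collects the 1 from the two tails, \<open>card ?X\<close> from the
    number of functions, and \<open>k\<close> from the lower bound on the denominator.\<close>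
  also have "\<dots> = 2 powr (1 + real (card ?X) - real k) * exp (- 2 * \<epsilon>\<^sup>2 * real (card ?X))"
    by (simp add: powr_add powr_diff powr_realpow)
  finally show ?thesis unfolding k .
qed

end
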